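(* Let $L=\{\ell_1,\ell_2,\ldots,\ell_s\}$ be a set of $s$ positive integers with $\ell_1<\ell_2<\cdots<\ell_s$, and let $\mathcal{F}\subseteq 2^{[n]}$ be an $L$-intersecting Sperner family of rank $M$. Then either $\mathcal{F}$ is trivially $\ell_1$-intersecting, in which case $$|\mathcal{F}|\le \sum_{i=0}^{s}\binom{n-2}{i}=\binom{n}{s}-\Omega_s(n^{s-1}),$$ or $|\mathcal{F}|=O_{M,s}(n^{s-1})$, i.e. $|\mathcal{F}|\le C\,n^{s-1}$ for a constant $C$ depending only on $M$ and $s$.
   Context: $[n]=\{1,\ldots,n\}$, $2^{[n]}$ is its power set. A family $\mathcal{F}\subseteq 2^{[n]}$ is $L$-intersecting if $|F\cap F'|\in L$ for any two distinct $F,F'\in\mathcal{F}$; it is Sperner if there are no distinct $A,B\in\mathcal{F}$ with $A\subseteq B$. The rank of $\mathcal{F}$ is $\max_{F\in\mathcal{F}}|F|$. $\mathcal{F}$ is trivially $\ell$-intersecting if there is a set $A$ with $|A|=\ell$ such that $A\subseteq F$ for every $F\in\mathcal{F}$. The notation $\binom{n}{s}-\Omega_s(n^{s-1})$ means $\binom{n}{s}$ minus a quantity that is at least $c\,n^{s-1}$ for some constant $c>0$ depending only on $s$ (for $n$ large). *)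

theory Defs
  imports Complex_Main
begin

definition intersecting_family :: "nat set \<Rightarrow> 'a set set \<Rightarrow> bool" where
  "intersecting_family L F \<longleftrightarrow> (\<forall>A\<in>F. \<forall>B\<in>F. A \<noteq> B \<longrightarrow> card (A \<inter> B) \<in> L)"

definition sperner_family :: "'a set set \<Rightarrow> bool" where
  "sperner_family F \<longleftrightarrow> \<not> (\<exists>A\<in>F. \<exists>B\<in>F. A \<noteq> B \<and> A \<subseteq> B)"

(* Meant for finite nonempty families of finite sets; unspecified on the empty family. *)
definition family_rank :: "'a set set \<Rightarrow> nat" where
  "family_rank F = Max (card ` F)"

(* Finiteness of A is explicit because card is 0 on infinite sets. *)
definition trivially_intersecting :: "nat \<Rightarrow> 'a set set \<Rightarrow> bool" where
  "trivially_intersecting l F \<longleftrightarrow> (\<exists>A. finite A \<and> card A = l \<and> (\<forall>B\<in>F. A \<subseteq> B))"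

end

theory Submission
  imports Defs "HOL-Library.Function_Algebras"
begin

text \<open>
  Fix a point \<open>v\<close>. To each member \<open>A\<close> of an \<open>L\<close>-intersecting Sperner family attach the
  polynomial \<open>\<Prod>(\<bar>A \<inter> X\<bar> - l)\<close> over the \<open>l \<in> L\<close> with \<open>l < \<bar>A\<bar>\<close>; by the Sperner property it
  vanishes at all other members but not at \<open>A\<close>. Substituting 1 for the variable of \<open>v\<close> keeps these
  polynomials independent: evaluation at the members containing \<open>v\<close> kills their coefficients, and
  the remaining polynomials do not involve \<open>v\<close> at all. Hence the family has at most
  \<open>\<Sum>i\<le>s. (\<bar>V\<bar> - 1) choose i\<close> members, \<open>V\<close> being the ground set. Removing the common
  \<open>l\<^sub>1\<close>-set gives the bound for trivially intersecting families.

  Otherwise let \<open>A\<close> be a member. Every member contains some \<open>l\<^sub>1\<close>-subset \<open>T\<close> of \<open>A\<close>. As \<open>T\<close> is not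
  contained in some member \<open>B\<close>, each member containing \<open>T\<close> also contains a point of \<open>B - T\<close>. The
  members containing a given set of size \<open>l\<^sub>1 + 1\<close> form an \<open>L - {l\<^sub>1}\<close>-intersecting family, so there
  are only \<open>O(n\<^sup>s\<^sup>-\<^sup>1)\<close> of them, and there are at most \<open>2\<^sup>M M\<close> choices for such sets.
\<close>

section \<open>Auxiliary facts on subfamilies, pointwise sums and counting small subsets\<close>

lemma sperner_family_subset: "sperner_family F \<Longrightarrow> G \<subseteq> F \<Longrightarrow> sperner_family G"
  unfolding sperner_family_def by blast

lemma sum_fun_apply: "(\<Sum>i\<in>S. f i) x = (\<Sum>i\<in>S. f i x)"
  by (induction S rule: infinite_finite_induct) auto

lemma card_subsets_card_le:
  assumes "finite W"
  shows "card {I. I \<subseteq> W \<and> card I \<le> s} = (\<Sum>i=0..s. card W choose i)"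
proof -
  have eq: "{I. I \<subseteq> W \<and> card I \<le> s} = (\<Union>i\<in>{0..s}. {I. I \<subseteq> W \<and> card I = i})"
    by auto
  have "card (\<Union>i\<in>{0..s}. {I. I \<subseteq> W \<and> card I = i})
      = (\<Sum>i=0..s. card {I. I \<subseteq> W \<and> card I = i})"
    using assms by (intro card_UN_disjoint) auto
  then show ?thesis
    by (simp add: eq n_subsets[OF assms])
qed

subsection \<open>Multilinear polynomials as functions on sets\<close>

text \<open>Makes span and independence results available for real functions, with pointwise
  addition.\<close>

interpretation fun_space: vector_space "\<lambda>(c::real) (f::'b \<Rightarrow> real) x. c * f x"
  by unfold_locales (auto simp: fun_eq_iff algebra_simps)

text \<open>The multilinear monomial with variables indexed by \<open>I\<close>, evaluated at the
  0/1 indicator vector of \<open>X\<close>.\<close>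

definition monomial_fun :: "'a set \<Rightarrow> 'a set \<Rightarrow> real" where
  "monomial_fun I X = of_bool (I \<subseteq> X)"

definition polys :: "'a set \<Rightarrow> nat \<Rightarrow> ('a set \<Rightarrow> real) set" where
  "polys W d = fun_space.span (monomial_fun ` {I. I \<subseteq> W \<and> card I \<le> d})"

lemma polys_mono: "d \<le> e \<Longrightarrow> polys W d \<subseteq> polys W e"
  unfolding polys_def by (intro fun_space.span_mono) auto

lemma polys_sum:
  assumes "\<And>i. i \<in> S \<Longrightarrow> f i \<in> polys W d"
  shows "(\<lambda>X. \<Sum>i\<in>S. f i X) \<in> polys W d"
proof -
  have "(\<Sum>i\<in>S. f i) \<in> polys W d"
    using assms unfolding polys_def by (rule fun_space.span_sum)
  moreover have "(\<Sum>i\<in>S. f i) = (\<lambda>X. \<Sum>i\<in>S. f i X)"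
    by (simp add: fun_eq_iff sum_fun_apply)
  ultimately show ?thesis by simp
qed

text \<open>At 0/1 points every variable equals its square, so multiplying the monomial of
  \<open>I\<close> by the variable of \<open>i\<close> gives the monomial of
  \<open>insert i I\<close>: products stay multilinear.\<close>

lemma polys_mult_var:
  assumes "p \<in> polys W d" "i \<in> W"
  shows "(\<lambda>X. of_bool (i \<in> X) * p X) \<in> polys W (Suc d)"
  using assms(1) unfolding polys_def
proof (induction rule: fun_space.span_induct_alt)
  case base
  have "(\<lambda>X. of_bool (i \<in> X) * (0 :: 'a set \<Rightarrow> real) X) = 0"
    by (simp add: fun_eq_iff)
  then show ?case
    by (simp only: fun_space.span_zero)
next
  case (step c x y)
  then obtain I where I: "I \<subseteq> W" "card I \<le> d" "x = monomial_fun I"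
    by auto
  have "card (insert i I) \<le> Suc d"
    using I(2) card_insert_le_m1[of "Suc d" I i] by simp
  then have "monomial_fun (insert i I) \<in> polys W (Suc d)"
    unfolding polys_def using I assms(2) by (intro fun_space.span_base) auto
  then have "(\<lambda>X. c * monomial_fun (insert i I) X) + (\<lambda>X. of_bool (i \<in> X) * y X) \<in> polys W (Suc d)"
    using step unfolding polys_def
    by (intro fun_space.span_add fun_space.span_scale) auto
  moreover have "(\<lambda>X. c * monomial_fun (insert i I) X) + (\<lambda>X. of_bool (i \<in> X) * y X)
      = (\<lambda>X. of_bool (i \<in> X) * ((\<lambda>X. c * x X) + y) X)"
    by (auto simp: fun_eq_iff monomial_fun_def I(3) algebra_simps)
  ultimately show ?case
    unfolding polys_def by simp
qed

lemma polys_mult_linear: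
  assumes p: "p \<in> polys W d" and "B \<subseteq> W"
  shows "(\<lambda>X. (c + (\<Sum>i\<in>B. of_bool (i \<in> X))) * p X) \<in> polys W (Suc d)"
proof -
  have "(\<lambda>X. c * p X) \<in> polys W (Suc d)"
    using p polys_mono[of d "Suc d" W] unfolding polys_def
    by (intro fun_space.span_scale) auto
  moreover have "(\<lambda>X. \<Sum>i\<in>B. of_bool (i \<in> X) * p X) \<in> polys W (Suc d)"
    using assms by (intro polys_sum polys_mult_var) auto
  ultimately have "(\<lambda>X. c * p X) + (\<lambda>X. \<Sum>i\<in>B. of_bool (i \<in> X) * p X) \<in> polys W (Suc d)"
    unfolding polys_def by (rule fun_space.span_add)
  moreover have "(\<lambda>X. c * p X) + (\<lambda>X. \<Sum>i\<in>B. of_bool (i \<in> X) * p X)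
      = (\<lambda>X. (c + (\<Sum>i\<in>B. of_bool (i \<in> X))) * p X)"
    by (simp add: fun_eq_iff algebra_simps sum_distrib_left)
  ultimately show ?thesis by simp
qed

lemma polys_prod_linear:
  assumes "finite L" "B \<subseteq> W"
  shows "(\<lambda>X. \<Prod>l\<in>L. c l + (\<Sum>i\<in>B. of_bool (i \<in> X))) \<in> polys W (card L)"
  using assms(1)
proof (induction rule: finite_induct)
  case empty
  have "monomial_fun {} \<in> polys W 0"
    unfolding polys_def by (intro fun_space.span_base) auto
  then show ?case
    by (simp add: monomial_fun_def[abs_def])
next
  case (insert l L)
  then show ?case
    using polys_mult_linear[OF insert.IH assms(2)] by simp
qed

subsection \<open>The polynomial bound for Sperner families\<close>

theorem card_intersecting_sperner_le:
  fixes V :: "'a set"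
  assumes V: "finite V" and F: "F \<subseteq> Pow V" and L: "finite L"
    and int: "intersecting_family L F" and sp: "sperner_family F" and v: "v \<in> V"
  shows "card F \<le> (\<Sum>i=0..card L. (card V - 1) choose i)"
proof -
  define W where "W = V - {v}"
  define L' where "L' A = {l\<in>L. l < card A}" for A :: "'a set"
  define g where "g A X = (\<Prod>l\<in>L' A. real (card (A \<inter> insert v X)) - real l)" for A X :: "'a set"
  have finF: "finite F" and finA: "\<And>A. A \<in> F \<Longrightarrow> finite A"
    using F V by (auto intro: finite_subset)
  have finL': "finite (L' A)" for A
    using L by (simp add: L'_def)
  have g_poly: "g A \<in> polys W (card L)" if "A \<in> F" for A
  proof -
    \<comment> \<open>The point \<open>v\<close> contributes a constant, so only variables from
      \<open>W\<close> remain.\<close>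
    have "real (card (A \<inter> insert v X)) = of_bool (v \<in> A) + (\<Sum>i\<in>A - {v}. of_bool (i \<in> X))" for X
    proof -
      have "card (A \<inter> insert v X) = card (A \<inter> {v}) + card ((A - {v}) \<inter> X)"
        using finA[OF that] by (subst card_Un_disjoint[symmetric]) (auto intro!: arg_cong[of _ _ card])
      moreover have "card (A \<inter> {v}) = of_bool (v \<in> A)"
        by auto
      moreover have "(\<Sum>i\<in>A - {v}. of_bool (i \<in> X)) = real (card ((A - {v}) \<inter> X))"
        using finA[OF that] by (simp add: of_bool_def sum.If_cases Int_def)
      ultimately show ?thesis by simp
    qed
    then have "g A = (\<lambda>X. \<Prod>l\<in>L' A. (of_bool (v \<in> A) - real l) + (\<Sum>i\<in>A - {v}. of_bool (i \<in> X)))"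
      by (auto simp: g_def fun_eq_iff intro!: prod.cong)
    also have "\<dots> \<in> polys W (card (L' A))"
      using F that by (intro polys_prod_linear finL') (auto simp: W_def)
    also have "\<dots> \<subseteq> polys W (card L)"
      using L by (intro polys_mono card_mono) (auto simp: L'_def)
    finally show ?thesis .
  qed
  have g_self: "g A A \<noteq> 0" if "A \<in> F" for A
  proof -
    have "card A \<le> card (A \<inter> insert v A)"
      using finA[OF that] by (intro card_mono) auto
    then show ?thesis
      using finL'[of A] by (auto simp: g_def L'_def)
  qed
  \<comment> \<open>Inserting \<open>v\<close> into \<open>B\<close> changes
    \<open>A \<inter> B\<close> only if \<open>v\<close> lies in \<open>A\<close> but not in
    \<open>B\<close>; this case is excluded.\<close>
  have g_other: "g A B = 0" if "A \<in> F" "B \<in> F" "A \<noteq> B" "\<not> (v \<in> A \<and> v \<notin> B)" for A B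
  proof -
    have eq: "A \<inter> insert v B = A \<inter> B"
      using that(4) by auto
    have "A \<inter> B \<subset> A"
      using that sp unfolding sperner_family_def by blast
    then have "card (A \<inter> B) < card A"
      using finA[OF that(1)] by (simp add: psubset_card_mono)
    moreover have "card (A \<inter> B) \<in> L"
      using int that unfolding intersecting_family_def by blast
    ultimately have "card (A \<inter> B) \<in> L' A"
      by (simp add: L'_def)
    then show ?thesis
      using finL'[of A] by (auto simp: g_def eq)
  qed
  \<comment> \<open>The excluded case holds for at most one order of a pair, so \<open>g A B\<close>
    or \<open>g B A\<close> is 0; if \<open>g A = g B\<close>, this contradicts
    \<open>g_self\<close>.\<close>
  have inj: "inj_on g F"
  proof (rule inj_onI, rule ccontr)
    fix A B assume AB: "A \<in> F" "B \<in> F" "g A = g B" "A \<noteq> B"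
    show False
      using g_other[of A B] g_other[of B A] g_self[of A] g_self[of B] AB by metis
  qed
  have indep: "\<not> fun_space.dependent (g ` F)"
  proof
    assume "fun_space.dependent (g ` F)"
    then obtain u where u: "\<exists>f\<in>g ` F. u f \<noteq> 0" "(\<Sum>f\<in>g ` F. (\<lambda>X. u f * f X)) = 0"
      using fun_space.dependent_finite[of "g ` F"] finF by auto
    define a where "a A = u (g A)" for A
    have sum0: "(\<Sum>A\<in>F. a A * g A X) = 0" for X
    proof -
      have "(\<Sum>f\<in>g ` F. (\<lambda>X. u f * f X)) X = 0"
        using u(2) by simp
      then show ?thesis
        using inj by (simp add: sum.reindex a_def sum_fun_apply)
    qed
    have at: "(\<Sum>A\<in>F. a A * g A B) = a B * g B B"
      if "B \<in> F" "\<And>A. A \<in> F \<Longrightarrow> A \<noteq> B \<Longrightarrow> a A = 0 \<or> g A B = 0" for B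
    proof -
      have "(\<Sum>A\<in>F - {B}. a A * g A B) = 0"
        using that(2) by (intro sum.neutral) auto
      then show ?thesis
        using sum.remove[OF finF that(1), of "\<lambda>A. a A * g A B"] by simp
    qed
    \<comment> \<open>At a member \<open>B\<close> containing \<open>v\<close>, every other
      \<open>g A\<close> vanishes.\<close>
    have a_in: "a B = 0" if "B \<in> F" "v \<in> B" for B
      using at[of B] sum0[of B] g_self[of B] g_other[of _ B] that by auto
    \<comment> \<open>If \<open>B\<close> avoids \<open>v\<close>, any other \<open>g A\<close> that
      may be nonzero at \<open>B\<close> has \<open>v \<in> A\<close>, so its coefficient is already
      0.\<close>
    have "a B = 0" if "B \<in> F" for B
      using at[of B] sum0[of B] g_self[of B] g_other[of _ B] a_in that by (metis mult_eq_0_iff)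
    then show False
      using u(1) by (auto simp: a_def)
  qed
  have finW: "finite W"
    using V by (simp add: W_def)
  have fin_mon: "finite {I. I \<subseteq> W \<and> card I \<le> card L}"
    using finW by simp
  have "card F = card (g ` F)"
    using inj by (simp add: card_image)
  also have "\<dots> \<le> card (monomial_fun ` {I. I \<subseteq> W \<and> card I \<le> card L})"
    using g_poly indep fin_mon
    by (intro conjunct2[OF fun_space.independent_span_bound]) (auto simp: polys_def)
  also have "\<dots> \<le> card {I. I \<subseteq> W \<and> card I \<le> card L}"
    using fin_mon by (rule card_image_le)
  also have "\<dots> = (\<Sum>i=0..card L. (card V - 1) choose i)"
    using card_subsets_card_le[OF finW] V v by (simp add: W_def)
  finally show ?thesis .
qed

lemma sum_choose_le_power:
  assumes "m \<le> n" "n \<ge> 1"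
  shows "(\<Sum>i=0..d. m choose i) \<le> (d + 1) * n ^ d"
proof -
  have "m choose i \<le> n ^ d" if "i \<le> d" for i
  proof -
    have "m choose i \<le> m ^ i"
      by (cases "i \<le> m") (auto intro: binomial_le_pow simp: binomial_eq_0)
    also have "\<dots> \<le> n ^ i"
      using assms by (simp add: power_mono)
    also have "\<dots> \<le> n ^ d"
      using assms that by (simp add: power_increasing)
    finally show ?thesis .
  qed
  then show ?thesis
    using sum_bounded_above[of "{0..d}" "\<lambda>i. m choose i" "n ^ d"] by simp
qed

subsection \<open>Trivially and nontrivially intersecting families\<close>

text \<open>Deleting the common set costs the ground set \<open>l \<ge> 1\<close> points and
  \<open>card_intersecting_sperner_le\<close> saves one more; hence
  \<open>card V - 2\<close>.\<close>

lemma card_trivially_intersecting_le: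
  assumes V: "finite V" and F: "F \<subseteq> Pow V" and L: "finite L" and l: "l \<ge> 1"
    and int: "intersecting_family L F" and sp: "sperner_family F" and triv: "trivially_intersecting l F"
  shows "card F \<le> (\<Sum>i=0..card L. (card V - 2) choose i)"
proof -
  obtain A where A: "finite A" "card A = l" "\<And>B. B \<in> F \<Longrightarrow> A \<subseteq> B"
    using triv unfolding trivially_intersecting_def by blast
  define G where "G = (\<lambda>B. B - A) ` F"
  have inj: "inj_on (\<lambda>B. B - A) F"
    using A(3) by (intro inj_onI) blast
  have card_G: "card G = card F"
    unfolding G_def using inj by (rule card_image)
  \<comment> \<open>The polynomial bound needs a ground point outside \<open>A\<close>; without one,
    \<open>A\<close> is the only possible member.\<close>
  consider "F = {}" | "F \<noteq> {}" "V \<subseteq> A" | v where "F \<noteq> {}" "v \<in> V - A"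
    by blast
  then show ?thesis
  proof cases
    case 1
    then show ?thesis by simp
  next
    case 2
    then have "F \<subseteq> {A}"
      using F A(3) by blast
    then have "card F \<le> 1"
      using card_mono[of "{A}" F] by simp
    also have "\<dots> \<le> (\<Sum>i=0..card L. (card V - 2) choose i)"
      using member_le_sum[of 0 "{0..card L}" "\<lambda>i. (card V - 2) choose i"] by simp
    finally show ?thesis .
  next
    case (3 v)
    have AV: "A \<subseteq> V"
      using 3 A(3) F by blast
    have GV: "G \<subseteq> Pow (V - A)"
      using F by (auto simp: G_def)
    \<comment> \<open>Subtraction truncates only for \<open>k < l\<close>, and no two members meet
      in so few points. Values that coincide after subtraction only lower the bound.\<close>
    have "intersecting_family ((\<lambda>k. k - l) ` L) G"
      unfolding intersecting_family_def
    proof (intro ballI impI)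
      fix X Y assume "X \<in> G" "Y \<in> G" "X \<noteq> Y"
      then obtain B C where BC: "B \<in> F" "C \<in> F" "X = B - A" "Y = C - A" "B \<noteq> C"
        by (auto simp: G_def)
      have "X \<inter> Y = (B \<inter> C) - A"
        using BC by blast
      moreover have "A \<subseteq> B \<inter> C"
        using A(3) BC by blast
      ultimately have "card (X \<inter> Y) = card (B \<inter> C) - l"
        using A by (simp add: card_Diff_subset)
      moreover have "card (B \<inter> C) \<in> L"
        using int BC unfolding intersecting_family_def by blast
      ultimately show "card (X \<inter> Y) \<in> (\<lambda>k. k - l) ` L"
        by blast
    qed
    moreover have "sperner_family G"
      using sp A(3) unfolding sperner_family_def G_def by blast
    ultimately have "card G \<le> (\<Sum>i=0..card ((\<lambda>k. k - l) ` L). (card (V - A) - 1) choose i)"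
      using V GV L 3 by (intro card_intersecting_sperner_le[where v = v]) auto
    also have "\<dots> \<le> (\<Sum>i=0..card L. (card (V - A) - 1) choose i)"
      using card_image_le[OF L] by (intro sum_mono2) auto
    also have "\<dots> \<le> (\<Sum>i=0..card L. (card V - 2) choose i)"
    proof (intro sum_mono binomial_right_mono)
      show "card (V - A) - 1 \<le> card V - 2"
        using A AV l by (simp add: card_Diff_subset)
    qed
    finally show ?thesis
      by (simp add: card_G)
  qed
qed

text \<open>Members containing \<open>U\<close> meet in at least \<open>card U\<close> points, so
  the size \<open>Min L\<close> never occurs; one size fewer lowers the degree of the bound by
  one.\<close>

lemma card_members_containing_le:
  assumes V: "finite V" "V \<noteq> {}" and F: "F \<subseteq> Pow V" and L: "finite L" "L \<noteq> {}"
    and int: "intersecting_family L F" and sp: "sperner_family F" and U: "card U > Min L"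
  shows "card {A\<in>F. U \<subseteq> A} \<le> card L * card V ^ (card L - 1)"
proof -
  have "intersecting_family (L - {Min L}) {A\<in>F. U \<subseteq> A}"
    unfolding intersecting_family_def
  proof (intro ballI impI)
    fix A B assume AB: "A \<in> {A\<in>F. U \<subseteq> A}" "B \<in> {A\<in>F. U \<subseteq> A}" "A \<noteq> B"
    then have "finite (A \<inter> B)"
      using F V finite_subset[of A V] by auto
    then have "card U \<le> card (A \<inter> B)"
      using AB by (intro card_mono) auto
    then show "card (A \<inter> B) \<in> L - {Min L}"
      using AB int U unfolding intersecting_family_def by auto
  qed
  moreover obtain v where "v \<in> V"
    using V by blast
  ultimately have "card {A\<in>F. U \<subseteq> A} \<le> (\<Sum>i=0..card (L - {Min L}). (card V - 1) choose i)"
    using F L V sperner_family_subset[OF sp]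
    by (intro card_intersecting_sperner_le[where v = v]) auto
  also have "\<dots> \<le> (card (L - {Min L}) + 1) * card V ^ card (L - {Min L})"
    using V by (intro sum_choose_le_power) (auto simp: Suc_le_eq card_gt_0_iff)
  also have "\<dots> = card L * card V ^ (card L - 1)"
    using L by (simp add: card_gt_0_iff)
  finally show ?thesis .
qed

lemma card_not_trivially_intersecting_le:
  assumes V: "finite V" "V \<noteq> {}" and F: "F \<subseteq> Pow V" and L: "finite L" "L \<noteq> {}"
    and int: "intersecting_family L F" and sp: "sperner_family F"
    and nontriv: "\<not> trivially_intersecting (Min L) F"
    and M: "\<And>A. A \<in> F \<Longrightarrow> card A \<le> M"
  shows "card F \<le> 2 ^ M * (Suc M * (card L * card V ^ (card L - 1)))"
proof (cases "F = {}")
  case False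
  define K where "K = card L * card V ^ (card L - 1)"
  have finA: "finite A" if "A \<in> F" for A
    using F V that finite_subset[of A V] by auto
  have finF: "finite F"
    using F V by (auto intro: finite_subset)
  have core: "card {A\<in>F. T \<subseteq> A} \<le> M * K" if T: "finite T" "card T = Min L" for T
  proof -
    obtain B where B: "B \<in> F" "\<not> T \<subseteq> B"
      using nontriv T unfolding trivially_intersecting_def by blast
    have "{A\<in>F. T \<subseteq> A} \<subseteq> (\<Union>x\<in>B - T. {A\<in>F. insert x T \<subseteq> A})"
    proof
      fix A assume A: "A \<in> {A\<in>F. T \<subseteq> A}"
      have "A \<noteq> B"
        using A B by auto
      then have "card (A \<inter> B) \<in> L"
        using int A B unfolding intersecting_family_def by blast
      then have "card T \<le> card (A \<inter> B)"
        using L T by simp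
      moreover have "card (T \<inter> B) < card T"
        using B T by (intro psubset_card_mono) auto
      moreover have "card (A \<inter> B) \<le> card (T \<inter> B)" if "A \<inter> B \<subseteq> T"
        using T that by (intro card_mono) auto
      \<comment> \<open>\<open>A \<inter> B\<close> has at least \<open>card T\<close> points but
        \<open>T \<inter> B\<close> has fewer, so \<open>A\<close> and \<open>B\<close> share a
        point outside \<open>T\<close>.\<close>
      ultimately have "\<not> A \<inter> B \<subseteq> T"
        by linarith
      then show "A \<in> (\<Union>x\<in>B - T. {A\<in>F. insert x T \<subseteq> A})"
        using A by auto
    qed
    then have "card {A\<in>F. T \<subseteq> A} \<le> card (\<Union>x\<in>B - T. {A\<in>F. insert x T \<subseteq> A})"
      using finF finA[OF B(1)] by (intro card_mono) auto
    also have "\<dots> \<le> (\<Sum>x\<in>B - T. card {A\<in>F. insert x T \<subseteq> A})"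
      using finA[OF B(1)] by (intro card_UN_le) auto
    also have "\<dots> \<le> card (B - T) * K"
    proof -
      have "card {A\<in>F. insert x T \<subseteq> A} \<le> K" if "x \<in> B - T" for x
        unfolding K_def using T that by (intro card_members_containing_le[OF V F L int sp]) auto
      then show ?thesis
        using sum_bounded_above[of "B - T" "\<lambda>x. card {A\<in>F. insert x T \<subseteq> A}" K] by simp
    qed
    also have "\<dots> \<le> M * K"
      using M[OF B(1)] card_mono[of B "B - T"] finA[OF B(1)] by (intro mult_right_mono) auto
    finally show ?thesis .
  qed
  obtain A where A: "A \<in> F"
    using False by blast
  have K: "K \<ge> 1"
    using V L by (simp add: K_def Suc_le_eq card_gt_0_iff)
  show ?thesis
  proof (cases "Min L \<le> card A")
    case True
    define Ts where "Ts = {T. T \<subseteq> A \<and> card T = Min L}"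
    have finTs: "finite Ts"
      using finA[OF A] by (simp add: Ts_def)
    have "F \<subseteq> (\<Union>T\<in>Ts. {B\<in>F. T \<subseteq> B})"
    proof
      fix B assume B: "B \<in> F"
      have "Min L \<le> card (A \<inter> B)"
        using True int A B L unfolding intersecting_family_def by (cases "A = B") auto
      then obtain T where "T \<subseteq> A \<inter> B" "card T = Min L"
        by (meson obtain_subset_with_card_n)
      then show "B \<in> (\<Union>T\<in>Ts. {B\<in>F. T \<subseteq> B})"
        using B by (auto simp: Ts_def)
    qed
    then have "card F \<le> card (\<Union>T\<in>Ts. {B\<in>F. T \<subseteq> B})"
      using finF finTs by (intro card_mono) auto
    also have "\<dots> \<le> (\<Sum>T\<in>Ts. card {B\<in>F. T \<subseteq> B})"
      using finTs by (rule card_UN_le)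
    also have "\<dots> \<le> card Ts * (M * K)"
      using sum_bounded_above[of Ts "\<lambda>T. card {B\<in>F. T \<subseteq> B}" "M * K"] core finA[OF A]
      by (auto simp: Ts_def intro: finite_subset)
    also have "\<dots> \<le> 2 ^ M * (Suc M * K)"
    proof (intro mult_mono)
      have "card Ts \<le> card (Pow A)"
        using finA[OF A] by (intro card_mono) (auto simp: Ts_def)
      also have "\<dots> \<le> 2 ^ M"
        using finA[OF A] M[OF A] by (simp add: card_Pow power_increasing)
      finally show "card Ts \<le> 2 ^ M" .
    qed auto
    finally show ?thesis
      by (simp add: K_def)
  next
    \<comment> \<open>A member with fewer than \<open>Min L\<close> points cannot meet another in an
      allowed size, so it is alone. \<open>Suc M\<close> instead of \<open>M\<close> keeps the bound
      positive even for \<open>M = 0\<close>.\<close>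
    case False
    have "F \<subseteq> {A}"
    proof
      fix B assume B: "B \<in> F"
      have "card (A \<inter> B) \<notin> L"
        using False L finA[OF A] card_mono[of A "A \<inter> B"] by (meson Int_lower1 Min_le order.trans)
      then show "B \<in> {A}"
        using int A B unfolding intersecting_family_def by blast
    qed
    then have "card F \<le> 1"
      using card_mono[of "{A}" F] by simp
    also have "\<dots> \<le> 2 ^ M * (Suc M * K)"
      using K by simp
    finally show ?thesis
      by (simp add: K_def)
  qed
qed simp

section \<open>Asymptotic gap between the binomial coefficient and the trivial-case bound\<close>

lemma choose_minus_sum_ge:
  "\<exists>c::real. c > 0 \<and> (\<forall>\<^sub>F n::nat in sequentially.
     c * real n ^ k \<le> real (n choose Suc k) - real (\<Sum>i=0..Suc k. (n - 2) choose i))"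
proof -
  \<comment> \<open>Pascal's rule, used twice, cancels the two top terms of the sum; what is left is
    one binomial coefficient of degree \<open>k\<close> minus terms of lower degree.\<close>
  have identity: "real ((m + 2) choose Suc k) - real (\<Sum>i=0..Suc k. m choose i)
      = real (Suc m choose k) - real (\<Sum>i<k. m choose i)" for m
    by (simp add: atLeast0AtMost lessThan_Suc_atMost[symmetric] numeral_2_eq_2)
  show ?thesis
  \<comment> \<open>For \<open>k = 0\<close> the gap is exactly 1; otherwise the lower terms are
    bounded using the exponent \<open>k - 1\<close>.\<close>
  proof (cases k)
    case 0
    have "1 \<le> real (n choose Suc k) - real (\<Sum>i=0..Suc k. (n - 2) choose i)" if "n \<ge> 2" for n
      using identity[of "n - 2"] that 0 by simp
    then show ?thesis
      by (intro exI[of _ 1] conjI eventually_sequentiallyI[of 2]) (simp_all only: 0, simp_all)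
  next
    case (Suc j)
    define q where "q = real k ^ k"
    have q: "q > 0"
      by (simp add: q_def Suc)
    \<comment> \<open>With \<open>m = n - 2\<close>, the coefficient \<open>m choose k\<close> is at
      least \<open>m ^ k / q\<close>. Half of this absorbs the lower terms, at most
      \<open>k * m ^ (k - 1)\<close>, once \<open>m \<ge> 2 * k * q\<close>; the factor
      \<open>2 ^ k\<close> pays for \<open>n \<le> 2 * m\<close>. The threshold on \<open>n\<close>
      ensures both, and \<open>k \<le> m\<close>.\<close>
    have "1 / (2 * q * 2 ^ k) * real n ^ k
        \<le> real (n choose Suc k) - real (\<Sum>i=0..Suc k. (n - 2) choose i)"
      if n: "n \<ge> 4 + k + 2 * k ^ Suc k" for n
    proof -
      define m where "m = n - 2"
      have m: "n = m + 2" "n \<le> 2 * m" "k \<le> m" "2 * k ^ Suc k \<le> m" "m \<ge> 1"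
        using n by (auto simp: m_def)
      have "real n ^ k \<le> (2 * real m) ^ k"
        using m by (intro power_mono) auto
      then have "1 / (2 * q * 2 ^ k) * real n ^ k \<le> real m ^ k / (2 * q)"
        using q by (simp add: field_simps power_mult_distrib)
      also have "\<dots> \<le> (real m / real k) ^ k - real k * real m ^ j"
      proof -
        have "real (2 * k ^ Suc k) \<le> real m"
          using m by (simp only: of_nat_le_iff)
        then have "2 * real k * q \<le> real m"
          by (simp add: q_def)
        then have "2 * real k * q * real m ^ j \<le> real m * real m ^ j"
          by (intro mult_right_mono) auto
        then have "2 * (q * (real k * real m ^ j)) \<le> real m ^ k"
          by (simp add: Suc algebra_simps)
        then show ?thesis
          using q by (simp add: power_divide field_simps flip: q_def)
      qed
      also have "\<dots> \<le> real (m choose k) - real (\<Sum>i<k. m choose i)"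
      proof -
        have "(\<Sum>i<k. m choose i) \<le> k * m ^ j"
          using sum_choose_le_power[of m m j] m
          by (simp add: Suc atLeast0AtMost lessThan_Suc_atMost)
        then have "real (\<Sum>i<k. m choose i) \<le> real k * real m ^ j"
          by (metis of_nat_le_iff of_nat_mult of_nat_power)
        moreover have "(real m / real k) ^ k \<le> real (m choose k)"
          using m by (intro binomial_ge_n_over_k_pow_k)
        ultimately show ?thesis
          by linarith
      qed
      also have "\<dots> \<le> real (Suc m choose k) - real (\<Sum>i<k. m choose i)"
        by (simp add: Suc)
      also have "\<dots> = real (n choose Suc k) - real (\<Sum>i=0..Suc k. (n - 2) choose i)"
        using identity[of m] m(1) by simp
      finally show ?thesis .
    qed
    then show ?thesis
      using q by (intro exI[of _ "1 / (2 * q * 2 ^ k)"] conjI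
        eventually_sequentiallyI[of "4 + k + 2 * k ^ Suc k"]) simp_all
  qed
qed

theorem theorem1p5:
  fixes s M :: nat
  assumes "s \<ge> 1"
  shows "(\<exists>C::real. \<forall>(n::nat) (L::nat set) (F::nat set set).
            n \<ge> 1 \<longrightarrow> finite L \<longrightarrow> card L = s \<longrightarrow> (\<forall>l\<in>L. l > 0) \<longrightarrow>
            F \<subseteq> Pow {1..n} \<longrightarrow> intersecting_family L F \<longrightarrow> sperner_family F \<longrightarrow>
            family_rank F = M \<longrightarrow>
              (trivially_intersecting (Min L) F \<or> real (card F) \<le> C * real n ^ (s - 1)) \<and>
              (trivially_intersecting (Min L) F \<longrightarrow> card F \<le> (\<Sum>i=0..s. (n - 2) choose i)))
       \<and> (\<exists>c::real. c > 0 \<and>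
            (\<forall>\<^sub>F n::nat in sequentially.
               c * real n ^ (s - 1) \<le> real (n choose s) - real (\<Sum>i=0..s. (n - 2) choose i)))"
proof (rule conjI, rule exI[of _ "real (2 ^ M * (Suc M * s))"], intro allI impI conjI)
  fix n :: nat and L :: "nat set" and F :: "nat set set"
  assume n: "n \<ge> 1" and L: "finite L" "card L = s" "\<forall>l\<in>L. l > 0"
    and F: "F \<subseteq> Pow {1..n}" and int: "intersecting_family L F" and sp: "sperner_family F"
    and rank: "family_rank F = M"
  have "L \<noteq> {}"
    using L assms by auto
  have "finite F"
    using F by (rule finite_subset) simp
  \<comment> \<open>\<open>Max\<close> is evaluated here only for a family with a member
    \<open>A\<close>, so the unspecified rank of the empty family does no harm.\<close>
  then have M: "card A \<le> M" if "A \<in> F" for A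
    using that rank unfolding family_rank_def by auto
  have "real (card F) \<le> real (2 ^ M * (Suc M * s)) * real n ^ (s - 1)"
    if "\<not> trivially_intersecting (Min L) F"
  proof -
    from that have "card F \<le> 2 ^ M * (Suc M * (s * n ^ (s - 1)))"
      using card_not_trivially_intersecting_le[of "{1..n}" F L M] n L \<open>L \<noteq> {}\<close> F int sp M by simp
    then have "real (card F) \<le> real (2 ^ M * (Suc M * (s * n ^ (s - 1))))"
      by (simp only: of_nat_le_iff)
    then show ?thesis
      by (simp add: algebra_simps)
  qed
  then show "trivially_intersecting (Min L) F
      \<or> real (card F) \<le> real (2 ^ M * (Suc M * s)) * real n ^ (s - 1)"
    by blast
  show "card F \<le> (\<Sum>i=0..s. (n - 2) choose i)" if "trivially_intersecting (Min L) F"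
  proof -
    have "Min L \<ge> 1"
      using L \<open>L \<noteq> {}\<close> by (simp add: Suc_le_eq)
    then show ?thesis
      using card_trivially_intersecting_le[of "{1..n}" F L "Min L"] L F int sp that by simp
  qed
next
  show "\<exists>c::real. c > 0 \<and> (\<forall>\<^sub>F n::nat in sequentially.
      c * real n ^ (s - 1) \<le> real (n choose s) - real (\<Sum>i=0..s. (n - 2) choose i))"
    using choose_minus_sum_ge[of "s - 1"] assms by simp
qed

end
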